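(* Let $X$ be a set and let $K:X\times X\to\mathbb{C}$ be a positive definite kernel with reproducing kernel Hilbert space $\mathscr{H}(K)$. Let $(B,\mathscr{F}_B,\mu)$ be a fixed sigma-finite measure space, let $\{k_x^{(B)}\}_{x\in X}$ be a subset of $L^2(B,\mu)$ indexed by $X$, and set, for $(x,y)\in X\times X$, $$K^{(\mu)}(x,y)=\int_B \overline{k_x^{(B)}(b)}\,k_y^{(B)}(b)\,d\mu(b).$$ Then the following conditions are equivalent: (i) $K^{(\mu)}\ll K$. (ii) The assignment $T_B:\sum_i c_iK(\cdot,x_i)\longmapsto\sum_i c_i k_{x_i}^{(B)}(\cdot)$ (finite sums, $c_i\in\mathbb{C}$, $x_i\in X$), extended by norm closure, is a well defined and contractive operator $T_B:\mathscr{H}(K)\to L^2(B,\mu)$. (iii) For $\varphi\in L^2(B,\mu)$ and $x\in X$ set $$(S_B\varphi)(x)=\int_B\overline{k_x^{(B)}(b)}\,\varphi(b)\,d\mu(b);$$ then $S_B$ is a well defined and contractive operator $S_B:L^2(B,\mu)\to\mathscr{H}(K)$. Moreover, if these conditions are satisfied, then $S_B=T_B^*$, where the adjoint refers to the two Hilbert spaces $\mathscr{H}(K)$ and $L^2(B,\mu)$ with their respective inner products.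
   Context: All inner products are linear in the second variable. A function $K:X\times X\to\mathbb{C}$ is positive definite (p.d.) if for every finite subset $\{x_i\}_{i=1}^N\subset X$ the matrix $(K(x_i,x_j))$ is positive semidefinite. $\mathscr{H}(K)$ denotes the reproducing kernel Hilbert space (RKHS) of $K$: the Hilbert space of functions on $X$ with $K(\cdot,x)\in\mathscr{H}(K)$ and $f(x)=\langle K(\cdot,x),f\rangle_{\mathscr{H}(K)}$ for all $x\in X$, $f\in\mathscr{H}(K)$. For p.d. kernels $K,L$ on $X\times X$, $K\ll L$ means: for all finite subsets $\{x_i\}_{i=1}^N\subset X$ and all $c_i\in\mathbb{C}$, $\sum_{i}\sum_{j}\overline{c}_ic_jK(x_i,x_j)\le\sum_{i}\sum_{j}\overline{c}_ic_jL(x_i,x_j)$. *)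

theory Defs
  imports "HOL-Analysis.Analysis" "HOL-Library.Complex_Order"
begin

section \<open>Complex Hilbert spaces on a carrier set\<close>

text \<open>The spaces below depend on a kernel or on a measure, so they cannot be instances of a type
  class. Operations are only meaningful on \<open>vec V\<close>.\<close>

record 'a hspace =
  vec :: "'a set"
  vadd :: "'a \<Rightarrow> 'a \<Rightarrow> 'a"
  vzero :: "'a"
  vscale :: "complex \<Rightarrow> 'a \<Rightarrow> 'a"
  vinner :: "'a \<Rightarrow> 'a \<Rightarrow> complex"

definition vdiff :: "'a hspace \<Rightarrow> 'a \<Rightarrow> 'a \<Rightarrow> 'a" where
  "vdiff V u v = vadd V u (vscale V (- 1) v)"

definition vnorm :: "'a hspace \<Rightarrow> 'a \<Rightarrow> real" where
  "vnorm V u = sqrt (Re (vinner V u u))"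

definition vlim :: "'a hspace \<Rightarrow> (nat \<Rightarrow> 'a) \<Rightarrow> 'a \<Rightarrow> bool" where
  "vlim V s u \<longleftrightarrow> (\<lambda>n. vnorm V (vdiff V (s n) u)) \<longlonglongrightarrow> 0"

definition vCauchy :: "'a hspace \<Rightarrow> (nat \<Rightarrow> 'a) \<Rightarrow> bool" where
  "vCauchy V s \<longleftrightarrow> (\<forall>e>0. \<exists>N. \<forall>m\<ge>N. \<forall>n\<ge>N. vnorm V (vdiff V (s m) (s n)) < e)"

text \<open>The inner product is linear in the second variable. In \<open>inner_pos\<close> the order is the one of
  \<open>Complex_Order\<close>, where \<open>0 \<le> z\<close> means that \<open>z\<close> is real and nonnegative.\<close>

locale hilbert_space =
  fixes V :: "'a hspace"
  assumes zero_closed: "vzero V \<in> vec V"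
    and add_closed: "\<lbrakk>u \<in> vec V; v \<in> vec V\<rbrakk> \<Longrightarrow> vadd V u v \<in> vec V"
    and scale_closed: "u \<in> vec V \<Longrightarrow> vscale V a u \<in> vec V"
    and add_assoc: "\<lbrakk>u \<in> vec V; v \<in> vec V; w \<in> vec V\<rbrakk>
      \<Longrightarrow> vadd V (vadd V u v) w = vadd V u (vadd V v w)"
    and add_commute: "\<lbrakk>u \<in> vec V; v \<in> vec V\<rbrakk> \<Longrightarrow> vadd V u v = vadd V v u"
    and add_zero: "u \<in> vec V \<Longrightarrow> vadd V u (vzero V) = u"
    and add_inverse: "u \<in> vec V \<Longrightarrow> vadd V u (vscale V (- 1) u) = vzero V"
    and scale_one: "u \<in> vec V \<Longrightarrow> vscale V 1 u = u"
    and scale_scale: "u \<in> vec V \<Longrightarrow> vscale V a (vscale V b u) = vscale V (a * b) u"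
    and scale_add_left: "u \<in> vec V \<Longrightarrow> vscale V (a + b) u = vadd V (vscale V a u) (vscale V b u)"
    and scale_add_right: "\<lbrakk>u \<in> vec V; v \<in> vec V\<rbrakk>
      \<Longrightarrow> vscale V a (vadd V u v) = vadd V (vscale V a u) (vscale V a v)"
    and inner_commute: "\<lbrakk>u \<in> vec V; v \<in> vec V\<rbrakk> \<Longrightarrow> vinner V u v = cnj (vinner V v u)"
    and inner_add: "\<lbrakk>u \<in> vec V; v \<in> vec V; w \<in> vec V\<rbrakk>
      \<Longrightarrow> vinner V u (vadd V v w) = vinner V u v + vinner V u w"
    and inner_scale: "\<lbrakk>u \<in> vec V; v \<in> vec V\<rbrakk> \<Longrightarrow> vinner V u (vscale V a v) = a * vinner V u v"
    and inner_pos: "u \<in> vec V \<Longrightarrow> 0 \<le> vinner V u u"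
    and inner_definite: "\<lbrakk>u \<in> vec V; vinner V u u = 0\<rbrakk> \<Longrightarrow> u = vzero V"
    and complete: "\<lbrakk>\<And>n. s n \<in> vec V; vCauchy V s\<rbrakk> \<Longrightarrow> \<exists>u\<in>vec V. vlim V s u"

section \<open>Operators\<close>

definition linear_operator :: "'a hspace \<Rightarrow> 'b hspace \<Rightarrow> ('a \<Rightarrow> 'b) \<Rightarrow> bool" where
  "linear_operator V W T \<longleftrightarrow>
     (\<forall>u\<in>vec V. T u \<in> vec W) \<and>
     (\<forall>u\<in>vec V. \<forall>v\<in>vec V. T (vadd V u v) = vadd W (T u) (T v)) \<and>
     (\<forall>a. \<forall>u\<in>vec V. T (vscale V a u) = vscale W a (T u))"

definition contractive_operator :: "'a hspace \<Rightarrow> 'b hspace \<Rightarrow> ('a \<Rightarrow> 'b) \<Rightarrow> bool" where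
  "contractive_operator V W T \<longleftrightarrow>
     linear_operator V W T \<and> (\<forall>u\<in>vec V. vnorm W (T u) \<le> vnorm V u)"

definition adjoint_operator :: "'a hspace \<Rightarrow> 'b hspace \<Rightarrow> ('a \<Rightarrow> 'b) \<Rightarrow> 'b \<Rightarrow> 'a" where
  "adjoint_operator V W T w =
     (THE v. v \<in> vec V \<and> (\<forall>u\<in>vec V. vinner W (T u) w = vinner V u v))"

definition norm_closure :: "'a hspace \<Rightarrow> 'b hspace \<Rightarrow> ('a \<times> 'b) set \<Rightarrow> ('a \<times> 'b) set" where
  "norm_closure V W G = {(u, w). u \<in> vec V \<and> w \<in> vec W \<and>
     (\<exists>s t. (\<forall>n. (s n, t n) \<in> G) \<and> vlim V s u \<and> vlim W t w)}"

definition well_defined_on :: "'a set \<Rightarrow> ('a \<times> 'b) set \<Rightarrow> bool" where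
  "well_defined_on A G \<longleftrightarrow> (\<forall>u\<in>A. \<exists>!w. (u, w) \<in> G)"

definition operator_of :: "('a \<times> 'b) set \<Rightarrow> 'a \<Rightarrow> 'b" where
  "operator_of G u = (THE w. (u, w) \<in> G)"

section \<open>Kernels and reproducing kernel Hilbert spaces\<close>

definition pos_def_kernel :: "('x \<Rightarrow> 'x \<Rightarrow> complex) \<Rightarrow> bool" where
  "pos_def_kernel K \<longleftrightarrow>
     (\<forall>F c. finite F \<longrightarrow> 0 \<le> (\<Sum>x\<in>F. \<Sum>y\<in>F. cnj (c x) * c y * K x y))"

text \<open>Comparison in \<open>Complex_Order\<close>: for positive definite kernels both sums are real.\<close>

definition kernel_le :: "('x \<Rightarrow> 'x \<Rightarrow> complex) \<Rightarrow> ('x \<Rightarrow> 'x \<Rightarrow> complex) \<Rightarrow> bool"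
    (infix "\<lless>" 50) where
  "K \<lless> L \<longleftrightarrow>
     (\<forall>F c. finite F \<longrightarrow>
        (\<Sum>x\<in>F. \<Sum>y\<in>F. cnj (c x) * c y * K x y) \<le> (\<Sum>x\<in>F. \<Sum>y\<in>F. cnj (c x) * c y * L x y))"

text \<open>\<open>H\<close> is determined by \<open>K\<close> up to the values of \<open>vinner H\<close> outside \<open>vec H\<close>.\<close>

locale rkhs = hilbert_space H
  for K :: "'x \<Rightarrow> 'x \<Rightarrow> complex" and H :: "('x \<Rightarrow> complex) hspace" +
  assumes add_pointwise: "vadd H = (\<lambda>f g x. f x + g x)"
    and zero_pointwise: "vzero H = (\<lambda>x. 0)"
    and scale_pointwise: "vscale H = (\<lambda>a f x. a * f x)"
    and kernel_section: "(\<lambda>y. K y x) \<in> vec H"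
    and reproducing: "f \<in> vec H \<Longrightarrow> f x = vinner H (\<lambda>y. K y x) f"

section \<open>The space of square integrable functions modulo a.e. equality\<close>

definition square_integrable :: "'b measure \<Rightarrow> ('b \<Rightarrow> complex) set" where
  "square_integrable M =
     {f \<in> borel_measurable M. integrable M (\<lambda>b. (cmod (f b))\<^sup>2)}"

definition L2_class :: "'b measure \<Rightarrow> ('b \<Rightarrow> complex) \<Rightarrow> ('b \<Rightarrow> complex) set" where
  "L2_class M f = {g \<in> square_integrable M. AE b in M. g b = f b}"

text \<open>An arbitrary representative. The operations and integrals below do not depend on the choice.\<close>

definition rep :: "('b \<Rightarrow> complex) set \<Rightarrow> 'b \<Rightarrow> complex" where
  "rep \<Phi> = (SOME f. f \<in> \<Phi>)"

definition L2 :: "'b measure \<Rightarrow> ('b \<Rightarrow> complex) set hspace" where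
  "L2 M = \<lparr>
     vec = L2_class M ` square_integrable M,
     vadd = (\<lambda>\<Phi> \<Psi>. L2_class M (\<lambda>b. rep \<Phi> b + rep \<Psi> b)),
     vzero = L2_class M (\<lambda>b. 0),
     vscale = (\<lambda>a \<Phi>. L2_class M (\<lambda>b. a * rep \<Phi> b)),
     vinner = (\<lambda>\<Phi> \<Psi>. \<integral>b. cnj (rep \<Phi> b) * rep \<Psi> b \<partial>M)\<rparr>"

section \<open>The kernel and the operators induced by a family in \<open>L\<^sup>2\<close>\<close>

definition K_mu :: "'b measure \<Rightarrow> ('x \<Rightarrow> 'b \<Rightarrow> complex) \<Rightarrow> 'x \<Rightarrow> 'x \<Rightarrow> complex" where
  "K_mu M k x y = (\<integral>b. cnj (k x b) * k y b \<partial>M)"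

text \<open>As an assignment on finite sums, which may have repeated points, this is a priori only a
  relation: different expressions of the same function could have different images.\<close>

definition T_assignment ::
    "('x \<Rightarrow> 'x \<Rightarrow> complex) \<Rightarrow> 'b measure \<Rightarrow> ('x \<Rightarrow> 'b \<Rightarrow> complex)
      \<Rightarrow> (('x \<Rightarrow> complex) \<times> ('b \<Rightarrow> complex) set) set" where
  "T_assignment K M k =
     {(\<lambda>y. \<Sum>i<n. c i * K y (x i), L2_class M (\<lambda>b. \<Sum>i<n. c i * k (x i) b)) |
        (n::nat) (c :: nat \<Rightarrow> complex) (x :: nat \<Rightarrow> 'x). True}"

definition T_graph ::
    "('x \<Rightarrow> 'x \<Rightarrow> complex) \<Rightarrow> ('x \<Rightarrow> complex) hspace \<Rightarrow> 'b measure \<Rightarrow> ('x \<Rightarrow> 'b \<Rightarrow> complex)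
      \<Rightarrow> (('x \<Rightarrow> complex) \<times> ('b \<Rightarrow> complex) set) set" where
  "T_graph K H M k = norm_closure H (L2 M) (T_assignment K M k)"

definition T_B ::
    "('x \<Rightarrow> 'x \<Rightarrow> complex) \<Rightarrow> ('x \<Rightarrow> complex) hspace \<Rightarrow> 'b measure \<Rightarrow> ('x \<Rightarrow> 'b \<Rightarrow> complex)
      \<Rightarrow> ('x \<Rightarrow> complex) \<Rightarrow> ('b \<Rightarrow> complex) set" where
  "T_B K H M k = operator_of (T_graph K H M k)"

definition S_B ::
    "'b measure \<Rightarrow> ('x \<Rightarrow> 'b \<Rightarrow> complex) \<Rightarrow> ('b \<Rightarrow> complex) set \<Rightarrow> 'x \<Rightarrow> complex" where
  "S_B M k \<Phi> = (\<lambda>x. \<integral>b. cnj (k x b) * rep \<Phi> b \<partial>M)"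

end

theory Submission
  imports Defs
begin

text \<open>For \<open>u = \<Sum> c\<^sub>i K(\<cdot>, x\<^sub>i)\<close> and \<open>w = \<Sum> c\<^sub>i k(x\<^sub>i)\<close> the two quadratic forms compared in
  \<open>K\<^sup>\<mu> \<lless> K\<close> are \<open>\<parallel>w\<parallel>\<^sup>2\<close> and \<open>\<parallel>u\<parallel>\<^sup>2\<close>, so (i) says exactly that the assignment \<open>u \<mapsto> w\<close> is
  contractive. Its domain is dense by the reproducing property, and completeness of \<open>L\<^sup>2\<close>
  extends it to a contraction \<open>T\<close>, which gives (ii). Riesz representation of
  \<open>u \<mapsto> \<langle>\<Phi>, T u\<rangle>\<close> in the RKHS, evaluated at the kernel sections, identifies \<open>T\<^sup>* \<Phi>\<close> with
  \<open>S \<Phi>\<close>, hence (iii). Conversely \<open>\<langle>w, w\<rangle> = \<langle>u, S w\<rangle>\<close>, so a contractive \<open>S\<close> forces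
  \<open>\<parallel>w\<parallel> \<le> \<parallel>u\<parallel>\<close>.\<close>

section \<open>Abstract Hilbert spaces\<close>

context hilbert_space
begin

lemma diff_closed: "\<lbrakk>u \<in> vec V; v \<in> vec V\<rbrakk> \<Longrightarrow> vdiff V u v \<in> vec V"
  by (simp add: vdiff_def add_closed scale_closed)

lemma inner_add_left:
  assumes "u \<in> vec V" "v \<in> vec V" "w \<in> vec V"
  shows "vinner V (vadd V u v) w = vinner V u w + vinner V v w"
  using inner_commute[of w "vadd V u v"] inner_commute[of w u] inner_commute[of w v] assms
  by (metis add_closed complex_cnj_add complex_cnj_cnj inner_add)

lemma inner_scale_left:
  assumes "u \<in> vec V" "v \<in> vec V"
  shows "vinner V (vscale V a u) v = cnj a * vinner V u v"
  using assms by (metis complex_cnj_cnj complex_cnj_mult inner_commute inner_scale scale_closed)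

lemma inner_diff_right:
  assumes "u \<in> vec V" "v \<in> vec V" "w \<in> vec V"
  shows "vinner V u (vdiff V v w) = vinner V u v - vinner V u w"
  using assms by (simp add: vdiff_def inner_add inner_scale scale_closed)

lemma inner_diff_left:
  assumes "u \<in> vec V" "v \<in> vec V" "w \<in> vec V"
  shows "vinner V (vdiff V u v) w = vinner V u w - vinner V v w"
  using assms by (simp add: vdiff_def inner_add_left inner_scale_left scale_closed)

lemmas closed = zero_closed add_closed scale_closed diff_closed
lemmas inner_simps = inner_add inner_add_left inner_scale inner_scale_left
  inner_diff_left inner_diff_right closed

lemma Re_inner_nonneg: "u \<in> vec V \<Longrightarrow> 0 \<le> Re (vinner V u u)"
  using inner_pos by (simp add: less_eq_complex_def)

lemma inner_self: "u \<in> vec V \<Longrightarrow> vinner V u u = of_real ((vnorm V u)\<^sup>2)"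
  using inner_pos Re_inner_nonneg by (simp add: vnorm_def less_eq_complex_def complex_eq_iff)

lemma norm_sq: "u \<in> vec V \<Longrightarrow> (vnorm V u)\<^sup>2 = Re (vinner V u u)"
  using Re_inner_nonneg by (simp add: vnorm_def)

lemma norm_nonneg: "u \<in> vec V \<Longrightarrow> 0 \<le> vnorm V u"
  using Re_inner_nonneg by (simp add: vnorm_def)

lemma diff_eq_zero_imp_eq:
  assumes "u \<in> vec V" "v \<in> vec V" "vdiff V u v = vzero V"
  shows "u = v"
proof -
  have "u = vadd V u (vadd V (vscale V (- 1) v) v)"
    using assms add_inverse add_commute add_zero scale_closed by metis
  also have "\<dots> = vadd V (vdiff V u v) v"
    using assms by (simp add: vdiff_def add_assoc[symmetric] scale_closed)
  finally show ?thesis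
    using assms by (metis add_commute add_zero zero_closed)
qed

lemma norm_diff_zero_imp_eq:
  assumes "u \<in> vec V" "v \<in> vec V" "vnorm V (vdiff V u v) = 0"
  shows "u = v"
  using assms inner_self inner_definite diff_eq_zero_imp_eq diff_closed
  by (metis of_real_0 zero_power2)

lemma eq_by_inner:
  assumes "u \<in> vec V" "v \<in> vec V" "\<And>w. w \<in> vec V \<Longrightarrow> vinner V w u = vinner V w v"
  shows "u = v"
proof -
  have "vinner V (vdiff V u v) (vdiff V u v) = 0"
    using assms by (simp add: inner_diff_right diff_closed)
  then show ?thesis
    using assms inner_definite diff_eq_zero_imp_eq diff_closed by blast
qed

lemma inner_zero: "u \<in> vec V \<Longrightarrow> vinner V u (vzero V) = 0"
  using inner_add[of u "vzero V" "vzero V"] add_zero[of "vzero V"] zero_closed by simp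

lemma inner_zero_left: "u \<in> vec V \<Longrightarrow> vinner V (vzero V) u = 0"
  using inner_commute[of "vzero V" u] inner_zero zero_closed by simp

lemma Cauchy_Schwarz:
  assumes u: "u \<in> vec V" and v: "v \<in> vec V"
  shows "cmod (vinner V u v) \<le> vnorm V u * vnorm V v"
proof (cases "vnorm V v = 0")
  case True
  then have "v = vzero V"
    using inner_self[OF v] inner_definite[OF v] by simp
  then show ?thesis using u v by (simp add: inner_zero norm_nonneg)
next
  case False
  define n where "n = (vnorm V v)\<^sup>2"
  have n: "n > 0" using False by (simp add: n_def)
  define a where "a = vinner V v u"
  have a': "vinner V u v = cnj a" using inner_commute[OF u v] by (simp add: a_def)
  define w where "w = vdiff V (vscale V (of_real n) u) (vscale V a v)"
  have "vinner V w w = of_real n * (of_real n * of_real ((vnorm V u)\<^sup>2) - a * cnj a)"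
    using u v unfolding w_def
    by (simp add: inner_simps inner_self[OF u] inner_self[OF v] n_def[symmetric] a_def[symmetric] a'
        algebra_simps)
  also have "\<dots> = of_real (n * (n * (vnorm V u)\<^sup>2 - (cmod a)\<^sup>2))"
    by (simp add: complex_norm_square[symmetric] del: of_real_power)
  finally have "0 \<le> n * (n * (vnorm V u)\<^sup>2 - (cmod a)\<^sup>2)"
    using Re_inner_nonneg[of w] u v by (simp add: w_def closed)
  then have "(cmod a)\<^sup>2 \<le> (vnorm V u * vnorm V v)\<^sup>2"
    using n by (simp add: zero_le_mult_iff n_def power_mult_distrib mult.commute)
  then show ?thesis
    unfolding a' complex_mod_cnj
    by (rule power2_le_imp_le) (use u v in \<open>simp add: norm_nonneg\<close>)
qed

lemma norm_triangle:
  assumes u: "u \<in> vec V" and v: "v \<in> vec V"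
  shows "vnorm V (vadd V u v) \<le> vnorm V u + vnorm V v"
proof -
  have "(vnorm V (vadd V u v))\<^sup>2 = Re (vinner V (vadd V u v) (vadd V u v))"
    using u v by (simp add: norm_sq closed)
  also have "\<dots> = (vnorm V u)\<^sup>2 + (vnorm V v)\<^sup>2 + 2 * Re (vinner V u v)"
    using u v inner_commute[OF v u] by (simp add: inner_simps norm_sq)
  also have "\<dots> \<le> (vnorm V u)\<^sup>2 + (vnorm V v)\<^sup>2 + 2 * (vnorm V u * vnorm V v)"
    using Cauchy_Schwarz[OF u v] complex_Re_le_cmod[of "vinner V u v"] by linarith
  also have "\<dots> = (vnorm V u + vnorm V v)\<^sup>2"
    by (simp add: power2_sum)
  finally show ?thesis
    by (rule power2_le_imp_le) (use u v in \<open>simp add: norm_nonneg\<close>)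
qed

lemma norm_scale: "u \<in> vec V \<Longrightarrow> vnorm V (vscale V a u) = cmod a * vnorm V u"
proof -
  assume u: "u \<in> vec V"
  have "vinner V (vscale V a u) (vscale V a u) = (a * cnj a) * vinner V u u"
    using u by (simp add: inner_simps)
  also have "\<dots> = of_real ((cmod a)\<^sup>2 * (vnorm V u)\<^sup>2)"
    by (simp add: complex_norm_square[symmetric] inner_self[OF u] del: of_real_power)
  finally have "vnorm V (vscale V a u) = sqrt ((cmod a * vnorm V u)\<^sup>2)"
    by (simp add: vnorm_def[of V "vscale V a u"] power_mult_distrib)
  then show ?thesis
    using norm_nonneg[OF u] by simp
qed

lemma norm_diff_commute:
  assumes "u \<in> vec V" "v \<in> vec V"
  shows "vnorm V (vdiff V u v) = vnorm V (vdiff V v u)"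
proof -
  have "vdiff V u v = vscale V (- 1) (vdiff V v u)"
    by (rule eq_by_inner) (use assms in \<open>auto simp: inner_simps\<close>)
  then show ?thesis using assms by (simp add: norm_scale closed)
qed

lemma norm_diff_triangle:
  assumes "u \<in> vec V" "v \<in> vec V" "w \<in> vec V"
  shows "vnorm V (vdiff V u w) \<le> vnorm V (vdiff V u v) + vnorm V (vdiff V v w)"
proof -
  have "vdiff V u w = vadd V (vdiff V u v) (vdiff V v w)"
    by (rule eq_by_inner) (use assms in \<open>auto simp: inner_simps\<close>)
  then show ?thesis using assms by (simp add: norm_triangle closed)
qed

lemma vlim_add:
  assumes "\<And>n. s n \<in> vec V" "\<And>n. t n \<in> vec V" "u \<in> vec V" "v \<in> vec V" "vlim V s u" "vlim V t v"
  shows "vlim V (\<lambda>n. vadd V (s n) (t n)) (vadd V u v)"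
  unfolding vlim_def
proof (rule tendsto_sandwich[OF _ _ tendsto_const])
  show "(\<lambda>n. vnorm V (vdiff V (s n) u) + vnorm V (vdiff V (t n) v)) \<longlonglongrightarrow> 0"
    using tendsto_add assms(5,6) unfolding vlim_def by fastforce
  have "vdiff V (vadd V (s n) (t n)) (vadd V u v) = vadd V (vdiff V (s n) u) (vdiff V (t n) v)" for n
    by (rule eq_by_inner) (use assms in \<open>auto simp: inner_simps\<close>)
  then show "\<forall>\<^sub>F n in sequentially. vnorm V (vdiff V (vadd V (s n) (t n)) (vadd V u v))
      \<le> vnorm V (vdiff V (s n) u) + vnorm V (vdiff V (t n) v)"
    using assms by (simp add: norm_triangle closed)
qed (use assms in \<open>simp add: norm_nonneg closed\<close>)

lemma vlim_scale:
  assumes "\<And>n. s n \<in> vec V" "u \<in> vec V" "vlim V s u"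
  shows "vlim V (\<lambda>n. vscale V a (s n)) (vscale V a u)"
proof -
  have "vdiff V (vscale V a (s n)) (vscale V a u) = vscale V a (vdiff V (s n) u)" for n
    by (rule eq_by_inner) (use assms in \<open>auto simp: inner_simps algebra_simps\<close>)
  then show ?thesis
    using assms tendsto_mult_right_zero unfolding vlim_def by (simp add: norm_scale closed)
qed

lemma vlim_const: "u \<in> vec V \<Longrightarrow> vlim V (\<lambda>_. u) u"
  by (simp add: vlim_def vnorm_def inner_simps)

lemma vlim_inner:
  assumes "\<And>n. s n \<in> vec V" "u \<in> vec V" "w \<in> vec V" "vlim V s u"
  shows "(\<lambda>n. vinner V (s n) w) \<longlonglongrightarrow> vinner V u w"
proof -
  have "(\<lambda>n. vinner V (s n) w - vinner V u w) \<longlonglongrightarrow> 0"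
  proof (rule Lim_null_comparison)
    show "(\<lambda>n. vnorm V (vdiff V (s n) u) * vnorm V w) \<longlonglongrightarrow> 0"
      using assms(4) unfolding vlim_def by (rule tendsto_mult_left_zero)
    have "cmod (vinner V (s n) w - vinner V u w) \<le> vnorm V (vdiff V (s n) u) * vnorm V w" for n
      using Cauchy_Schwarz[of "vdiff V (s n) u" w] assms by (simp add: inner_simps)
    then show "\<forall>\<^sub>F n in sequentially. cmod (vinner V (s n) w - vinner V u w)
        \<le> vnorm V (vdiff V (s n) u) * vnorm V w" by simp
  qed
  then show ?thesis by (rule LIM_zero_cancel)
qed

lemma vlim_norm:
  assumes "\<And>n. s n \<in> vec V" "u \<in> vec V" "vlim V s u"
  shows "(\<lambda>n. vnorm V (s n)) \<longlonglongrightarrow> vnorm V u"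
proof -
  have "(\<lambda>n. vnorm V (s n) - vnorm V u) \<longlonglongrightarrow> 0"
  proof (rule Lim_null_comparison)
    show "(\<lambda>n. vnorm V (vdiff V (s n) u)) \<longlonglongrightarrow> 0"
      using assms(3) unfolding vlim_def .
    have z: "vdiff V x (vzero V) = x" if "x \<in> vec V" for x
      by (rule eq_by_inner) (use that in \<open>auto simp: inner_simps inner_zero\<close>)
    have "\<bar>vnorm V (s n) - vnorm V u\<bar> \<le> vnorm V (vdiff V (s n) u)" for n
      using norm_diff_triangle[OF assms(1,2) zero_closed, of n]
        norm_diff_triangle[OF assms(2,1) zero_closed, of n]
        norm_diff_commute[OF assms(2,1), of n] z[OF assms(1), of n] z[OF assms(2)] by simp
    then show "\<forall>\<^sub>F n in sequentially. norm (vnorm V (s n) - vnorm V u)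
        \<le> vnorm V (vdiff V (s n) u)" by simp
  qed
  then show ?thesis by (rule LIM_zero_cancel)
qed

lemma vlim_imp_vCauchy:
  assumes "\<And>n. s n \<in> vec V" "u \<in> vec V" "vlim V s u"
  shows "vCauchy V s"
  unfolding vCauchy_def
proof (intro allI impI)
  fix e :: real assume "e > 0"
  then have "\<forall>\<^sub>F n in sequentially. vnorm V (vdiff V (s n) u) < e / 2"
    using assms(3) unfolding vlim_def by (intro order_tendstoD) auto
  then obtain N where N: "\<And>n. n \<ge> N \<Longrightarrow> vnorm V (vdiff V (s n) u) < e / 2"
    by (auto simp: eventually_sequentially)
  have "vnorm V (vdiff V (s m) (s n)) < e" if "m \<ge> N" "n \<ge> N" for m n
    using norm_diff_triangle[of "s m" u "s n"] norm_diff_commute[of u "s n"]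
      N[OF that(1)] N[OF that(2)] assms by simp
  then show "\<exists>N. \<forall>m\<ge>N. \<forall>n\<ge>N. vnorm V (vdiff V (s m) (s n)) < e" by blast
qed

text \<open>The representing vector is the limit of a minimising sequence in \<open>D\<close> for
  \<open>\<parallel>d\<parallel>\<^sup>2 - 2 Re (l d)\<close>; the parallelogram law makes this sequence Cauchy. The case
  \<open>D = vec V\<close> is the Riesz theorem, and \<open>l = \<langle>u, \<cdot>\<rangle>\<close> yields the density criterion below.\<close>

lemma functional_representation:
  assumes D: "D \<subseteq> vec V" "vzero V \<in> D"
    and D_add: "\<And>d e. \<lbrakk>d \<in> D; e \<in> D\<rbrakk> \<Longrightarrow> vadd V d e \<in> D"
    and D_scale: "\<And>a d. d \<in> D \<Longrightarrow> vscale V a d \<in> D"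
    and l_add: "\<And>d e. \<lbrakk>d \<in> D; e \<in> D\<rbrakk> \<Longrightarrow> l (vadd V d e) = l d + l e"
    and l_scale: "\<And>a d. d \<in> D \<Longrightarrow> l (vscale V a d) = a * l d"
    and l_bound: "\<And>d. d \<in> D \<Longrightarrow> cmod (l d) \<le> C * vnorm V d"
  obtains s v where "\<And>n. s n \<in> D" "v \<in> vec V" "vlim V s v" "\<And>d. d \<in> D \<Longrightarrow> vinner V v d = l d"
proof -
  have DV: "d \<in> vec V" if "d \<in> D" for d using D that by blast
  define J where "J d = (vnorm V d)\<^sup>2 - 2 * Re (l d)" for d
  have J_lower: "- C\<^sup>2 \<le> J d" if "d \<in> D" for d
  proof -
    have "Re (l d) \<le> C * vnorm V d"
      using l_bound[OF that] complex_Re_le_cmod[of "l d"] by linarith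
    moreover have "0 \<le> (vnorm V d - C)\<^sup>2" by simp
    ultimately show ?thesis by (simp add: J_def power2_diff algebra_simps)
  qed
  define m where "m = Inf (J ` D)"
  have bdd: "bdd_below (J ` D)" by (rule bdd_belowI2) (rule J_lower)
  have m_le: "m \<le> J d" if "d \<in> D" for d
    unfolding m_def using that bdd by (intro cInf_lower) auto
  have "\<exists>d\<in>D. J d < m + 1 / (Suc n)" for n
    using cInf_lessD[of "J ` D" "m + 1 / (Suc n)"] D(2) by (auto simp: m_def)
  then obtain s where s: "\<And>n. s n \<in> D" "\<And>n. J (s n) < m + 1 / (Suc n)" by metis
  have par: "(vnorm V (vdiff V a b))\<^sup>2 \<le> 2 * (J a + J b) - 4 * m" if "a \<in> D" "b \<in> D" for a b
  proof -
    have "J (vscale V (1/2) (vadd V a b)) = (J a + J b) / 2 - (vnorm V (vdiff V a b))\<^sup>2 / 4"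
      using that by (simp add: J_def norm_sq DV inner_simps l_add l_scale D_add field_simps)
    moreover have "m \<le> J (vscale V (1/2) (vadd V a b))"
      by (intro m_le D_scale D_add that)
    ultimately show ?thesis by (simp add: field_simps)
  qed
  have "vCauchy V s"
    unfolding vCauchy_def
  proof (intro allI impI)
    fix e :: real assume e: "e > 0"
    obtain N :: nat where N: "4 / e\<^sup>2 < real N" using reals_Archimedean2 by blast
    have "vnorm V (vdiff V (s i) (s j)) < e" if ij: "i \<ge> N" "j \<ge> N" for i j
    proof -
      have N0: "real N > 0" using N e by (smt (verit) divide_pos_pos zero_less_power)
      have le: "1 / real (Suc i) \<le> 1 / N" "1 / real (Suc j) \<le> 1 / N"
        using ij N0 by (auto intro!: divide_left_mono)
      have "(vnorm V (vdiff V (s i) (s j)))\<^sup>2 < 4 * (1 / N)"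
        using par[OF s(1) s(1), of i j] s(2)[of i] s(2)[of j] le by argo
      also have "\<dots> < e\<^sup>2" using N N0 e by (simp add: field_simps)
      finally show ?thesis using e by (simp add: power2_less_imp_less)
    qed
    then show "\<exists>N. \<forall>m\<ge>N. \<forall>n\<ge>N. vnorm V (vdiff V (s m) (s n)) < e" by blast
  qed
  then obtain v where v: "v \<in> vec V" "vlim V s v"
    using complete s(1) DV by blast
  have Re_eq: "Re (vinner V v d) = Re (l d)" if d: "d \<in> D" for d
  proof -
    define r where "r = Re (vinner V v d - l d)"
    define N where "N = (vnorm V d)\<^sup>2"
    have ineq: "0 \<le> 2 * t * r + t\<^sup>2 * N" for t :: real
    proof -
      have "0 \<le> 1 / (Suc n) + 2 * t * Re (vinner V (s n) d - l d) + t\<^sup>2 * N" for n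
      proof -
        have "(vnorm V (vadd V (s n) (vscale V (of_real t) d)))\<^sup>2
            = (vnorm V (s n))\<^sup>2 + 2 * t * Re (vinner V (s n) d) + t\<^sup>2 * N"
          using d s(1)[of n] inner_commute[of d "s n"]
          by (simp add: N_def norm_sq DV inner_simps power2_eq_square[of t] algebra_simps)
        then have "J (vadd V (s n) (vscale V (of_real t) d))
            = J (s n) + 2 * t * Re (vinner V (s n) d - l d) + t\<^sup>2 * N"
          using d s(1)[of n] by (simp add: J_def l_add l_scale D_scale algebra_simps)
        then show ?thesis
          using m_le[of "vadd V (s n) (vscale V (of_real t) d)"] s(2)[of n] s(1)[of n] d D_add D_scale
          by simp
      qed
      moreover have "(\<lambda>n. 1 / (Suc n) + 2 * t * Re (vinner V (s n) d - l d) + t\<^sup>2 * N)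
          \<longlonglongrightarrow> 0 + 2 * t * r + t\<^sup>2 * N"
        unfolding r_def
        by (intro tendsto_intros LIMSEQ_Suc[OF lim_1_over_n] vlim_inner)
          (use v s DV d in auto)
      ultimately have "0 \<le> 0 + 2 * t * r + t\<^sup>2 * N"
        by (intro LIMSEQ_le_const) auto
      then show ?thesis by simp
    qed
    define q where "q = r / (N + 1)"
    have "N \<ge> 0" by (simp add: N_def)
    then have r: "r = q * (N + 1)" by (simp add: q_def)
    have "0 \<le> 2 * (- q) * r + (- q)\<^sup>2 * N" by (rule ineq)
    also have "\<dots> = - (q\<^sup>2 * (N + 2))" by (simp add: r power2_eq_square algebra_simps)
    finally have "q = 0" using \<open>N \<ge> 0\<close> by (auto simp: mult_le_0_iff)
    then have "r = 0" using r by simp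
    then show ?thesis by (simp add: r_def)
  qed
  have "vinner V v d = l d" if d: "d \<in> D" for d
    using Re_eq[OF d] Re_eq[OF D_scale[OF d, of "- \<i>"]] d v DV
    by (simp add: complex_eq_iff inner_scale l_scale)
  then show ?thesis using that s v by blast
qed

lemma dense_if_orthogonal_trivial:
  assumes D: "D \<subseteq> vec V" "vzero V \<in> D"
    and D_add: "\<And>d e. \<lbrakk>d \<in> D; e \<in> D\<rbrakk> \<Longrightarrow> vadd V d e \<in> D"
    and D_scale: "\<And>a d. d \<in> D \<Longrightarrow> vscale V a d \<in> D"
    and orth: "\<And>v. \<lbrakk>v \<in> vec V; \<And>d. d \<in> D \<Longrightarrow> vinner V d v = 0\<rbrakk> \<Longrightarrow> v = vzero V"
    and u: "u \<in> vec V"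
  obtains s where "\<And>n. s n \<in> D" "vlim V s u"
proof -
  have DV: "d \<in> vec V" if "d \<in> D" for d using D that by blast
  obtain s v where sv: "\<And>n. s n \<in> D" "v \<in> vec V" "vlim V s v"
    "\<And>d. d \<in> D \<Longrightarrow> vinner V v d = vinner V u d"
    by (rule functional_representation[of D "vinner V u" "vnorm V u"])
      (use assms DV Cauchy_Schwarz inner_add inner_scale in auto)
  have "vdiff V u v = vzero V"
  proof (rule orth)
    fix d assume d: "d \<in> D"
    show "vinner V d (vdiff V u v) = 0"
      using sv(4)[OF d] inner_commute[OF u DV[OF d]] inner_commute[OF sv(2) DV[OF d]]
      by (metis DV[OF d] complex_cnj_cnj diff_self inner_commute inner_diff_right sv(2) u)
  qed (use u sv in \<open>simp add: closed\<close>)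
  then have "u = v" using diff_eq_zero_imp_eq u sv by blast
  then show ?thesis using that sv by blast
qed

end

lemma norm_closure_of_contraction:
  assumes V: "hilbert_space V" and W: "hilbert_space W"
    and G: "G \<subseteq> vec V \<times> vec W"
    and G_add: "\<And>u v w z. \<lbrakk>(u, w) \<in> G; (v, z) \<in> G\<rbrakk> \<Longrightarrow> (vadd V u v, vadd W w z) \<in> G"
    and G_scale: "\<And>a u w. (u, w) \<in> G \<Longrightarrow> (vscale V a u, vscale W a w) \<in> G"
    and G_contractive: "\<And>u w. (u, w) \<in> G \<Longrightarrow> vnorm W w \<le> vnorm V u"
    and dense: "\<And>u. u \<in> vec V \<Longrightarrow> \<exists>s. (\<forall>n. s n \<in> Domain G) \<and> vlim V s u"
  shows "well_defined_on (vec V) (norm_closure V W G)"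
    and "contractive_operator V W (operator_of (norm_closure V W G))"
proof -
  interpret V: hilbert_space V by fact
  interpret W: hilbert_space W by fact
  let ?N = "norm_closure V W G"
  have GV: "u \<in> vec V" and GW: "w \<in> vec W" if "(u, w) \<in> G" for u w
    using G that by auto
  have N_add: "(vadd V u v, vadd W w z) \<in> ?N" if uw: "(u, w) \<in> ?N" and vz: "(v, z) \<in> ?N" for u v w z
  proof -
    obtain s t where st: "\<And>n. (s n, t n) \<in> G" "vlim V s u" "vlim W t w"
      using uw unfolding norm_closure_def by auto
    obtain s' t' where st': "\<And>n. (s' n, t' n) \<in> G" "vlim V s' v" "vlim W t' z"
      using vz unfolding norm_closure_def by auto
    have c: "u \<in> vec V" "v \<in> vec V" "w \<in> vec W" "z \<in> vec W"
      using uw vz unfolding norm_closure_def by auto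
    have "vlim V (\<lambda>n. vadd V (s n) (s' n)) (vadd V u v)"
      using st st' c GV by (intro V.vlim_add) blast+
    moreover have "vlim W (\<lambda>n. vadd W (t n) (t' n)) (vadd W w z)"
      using st st' c GW by (intro W.vlim_add) blast+
    moreover have "(vadd V (s n) (s' n), vadd W (t n) (t' n)) \<in> G" for n
      using st st' by (intro G_add) auto
    ultimately show ?thesis
      unfolding norm_closure_def using c by (auto simp: V.closed W.closed
        intro!: exI[of _ "\<lambda>n. vadd V (s n) (s' n)"] exI[of _ "\<lambda>n. vadd W (t n) (t' n)"])
  qed
  have N_scale: "(vscale V a u, vscale W a w) \<in> ?N" if uw: "(u, w) \<in> ?N" for a u w
  proof -
    obtain s t where st: "\<And>n. (s n, t n) \<in> G" "vlim V s u" "vlim W t w"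
      using uw unfolding norm_closure_def by auto
    have c: "u \<in> vec V" "w \<in> vec W"
      using uw unfolding norm_closure_def by auto
    have "vlim V (\<lambda>n. vscale V a (s n)) (vscale V a u)"
      using st c GV by (intro V.vlim_scale) blast+
    moreover have "vlim W (\<lambda>n. vscale W a (t n)) (vscale W a w)"
      using st c GW by (intro W.vlim_scale) blast+
    moreover have "(vscale V a (s n), vscale W a (t n)) \<in> G" for n
      using st by (intro G_scale) auto
    ultimately show ?thesis
      unfolding norm_closure_def using c by (auto simp: V.closed W.closed
        intro!: exI[of _ "\<lambda>n. vscale V a (s n)"] exI[of _ "\<lambda>n. vscale W a (t n)"])
  qed
  have N_contractive: "vnorm W w \<le> vnorm V u" if uw: "(u, w) \<in> ?N" for u w
  proof -
    obtain s t where st: "\<And>n. (s n, t n) \<in> G" "vlim V s u" "vlim W t w"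
      using uw unfolding norm_closure_def by auto
    have c: "u \<in> vec V" "w \<in> vec W"
      using uw unfolding norm_closure_def by auto
    have "(\<lambda>n. vnorm V (s n)) \<longlonglongrightarrow> vnorm V u"
      using st c GV by (intro V.vlim_norm) blast+
    moreover have "(\<lambda>n. vnorm W (t n)) \<longlonglongrightarrow> vnorm W w"
      using st c GW by (intro W.vlim_norm) blast+
    ultimately show ?thesis
      using G_contractive[OF st(1)] by (intro LIMSEQ_le) auto
  qed
  have ex: "\<exists>w. (u, w) \<in> ?N" if u: "u \<in> vec V" for u
  proof -
    obtain s where s: "\<And>n. s n \<in> Domain G" "vlim V s u" using dense[OF u] by auto
    then have "\<forall>n. \<exists>w. (s n, w) \<in> G" by auto
    then obtain t where t: "\<And>n. (s n, t n) \<in> G" by metis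
    have "vCauchy V s" using s t GV u by (intro V.vlim_imp_vCauchy) blast+
    moreover have "vnorm W (vdiff W (t m) (t n)) \<le> vnorm V (vdiff V (s m) (s n))" for m n
      unfolding vdiff_def using t by (intro G_contractive G_add G_scale)
    ultimately have "vCauchy W t"
      unfolding vCauchy_def by (meson le_less_trans)
    then obtain w where w: "w \<in> vec W" "vlim W t w" using W.complete t GW by blast
    then show ?thesis unfolding norm_closure_def using u s t by auto
  qed
  have unique: "w = z" if uw: "(u, w) \<in> ?N" and uz: "(u, z) \<in> ?N" for u w z
  proof -
    have c: "u \<in> vec V" "w \<in> vec W" "z \<in> vec W"
      using uw uz unfolding norm_closure_def by auto
    have "vnorm W (vdiff W w z) \<le> vnorm V (vdiff V u u)"
      unfolding vdiff_def by (intro N_contractive N_add N_scale uw uz)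
    also have "\<dots> = 0" using c by (simp add: vnorm_def V.inner_simps)
    finally show ?thesis
      using W.norm_nonneg[OF W.diff_closed, of w z] c by (intro W.norm_diff_zero_imp_eq) auto
  qed
  show wd: "well_defined_on (vec V) ?N"
    unfolding well_defined_on_def using ex unique by blast
  have op: "(u, operator_of ?N u) \<in> ?N" if "u \<in> vec V" for u
    unfolding operator_of_def using wd that unfolding well_defined_on_def by (metis theI')
  have op_eq: "operator_of ?N u = w" if "(u, w) \<in> ?N" for u w
    using op unique that unfolding norm_closure_def by blast
  show "contractive_operator V W (operator_of ?N)"
    unfolding contractive_operator_def linear_operator_def
  proof (intro conjI ballI allI)
    fix u assume u: "u \<in> vec V"
    show "operator_of ?N u \<in> vec W" using op[OF u] unfolding norm_closure_def by auto
    show "vnorm W (operator_of ?N u) \<le> vnorm V u" using op[OF u] by (rule N_contractive)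
    show "operator_of ?N (vscale V a u) = vscale W a (operator_of ?N u)" for a
      by (intro op_eq N_scale op u)
    fix v assume "v \<in> vec V"
    then show "operator_of ?N (vadd V u v) = vadd W (operator_of ?N u) (operator_of ?N v)"
      by (intro op_eq N_add op u)
  qed
qed

section \<open>Completeness of the space of square integrable functions\<close>

lemma cnj_measurable [measurable]: "cnj \<in> borel_measurable borel"
  by (intro borel_measurable_continuous_onI continuous_intros)

lemma square_integrable_measurable [measurable_dest]:
  "f \<in> square_integrable M \<Longrightarrow> f \<in> borel_measurable M"
  by (simp add: square_integrable_def)

lemma square_integrable_integrable:
  "f \<in> square_integrable M \<Longrightarrow> integrable M (\<lambda>b. (cmod (f b))\<^sup>2)"
  by (simp add: square_integrable_def)

lemma square_integrable_zero: "(\<lambda>b. 0) \<in> square_integrable M"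
  by (simp add: square_integrable_def)

lemma square_integrable_scale:
  assumes "f \<in> square_integrable M"
  shows "(\<lambda>b. a * f b) \<in> square_integrable M"
  using assms by (auto simp: square_integrable_def norm_mult power_mult_distrib)

lemma square_integrable_add:
  assumes [measurable]: "f \<in> square_integrable M" "g \<in> square_integrable M"
  shows "(\<lambda>b. f b + g b) \<in> square_integrable M"
proof -
  have "integrable M (\<lambda>b. (cmod (f b + g b))\<^sup>2)"
  proof (rule Bochner_Integration.integrable_bound)
    show "integrable M (\<lambda>b. 2 * (cmod (f b))\<^sup>2 + 2 * (cmod (g b))\<^sup>2)"
      using assms square_integrable_integrable by fastforce
    have "(cmod (x + y))\<^sup>2 \<le> 2 * (cmod x)\<^sup>2 + 2 * (cmod y)\<^sup>2" for x y
    proof -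
      have "(cmod (x + y))\<^sup>2 \<le> (cmod x + cmod y)\<^sup>2"
        by (simp add: norm_triangle_ineq)
      also have "\<dots> \<le> 2 * (cmod x)\<^sup>2 + 2 * (cmod y)\<^sup>2"
        using zero_le_power2[of "cmod x - cmod y"] by (simp add: power2_sum power2_diff)
      finally show ?thesis .
    qed
    then show "AE b in M. norm ((cmod (f b + g b))\<^sup>2) \<le> norm (2 * (cmod (f b))\<^sup>2 + 2 * (cmod (g b))\<^sup>2)"
      by simp
  qed simp
  then show ?thesis by (simp add: square_integrable_def)
qed

lemma square_integrable_uminus:
  "f \<in> square_integrable M \<Longrightarrow> (\<lambda>b. - f b) \<in> square_integrable M"
  by (simp add: square_integrable_def)

lemma square_integrable_diff:
  assumes "f \<in> square_integrable M" "g \<in> square_integrable M"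
  shows "(\<lambda>b. f b - g b) \<in> square_integrable M"
  using square_integrable_add[OF assms(1) square_integrable_uminus[OF assms(2)]] by simp

lemma square_integrable_sum:
  assumes "\<And>i. i \<in> F \<Longrightarrow> f i \<in> square_integrable M"
  shows "(\<lambda>b. \<Sum>i\<in>F. f i b) \<in> square_integrable M"
  using assms by (induction F rule: infinite_finite_induct)
    (auto intro: square_integrable_zero square_integrable_add)

lemma integrable_cnj_mult:
  assumes [measurable]: "f \<in> square_integrable M" "g \<in> square_integrable M"
  shows "integrable M (\<lambda>b. cnj (f b) * g b)"
proof (rule Bochner_Integration.integrable_bound)
  show "integrable M (\<lambda>b. (cmod (f b))\<^sup>2 + (cmod (g b))\<^sup>2)"
    using assms square_integrable_integrable by fastforce
  have "cmod x * cmod y \<le> (cmod x)\<^sup>2 + (cmod y)\<^sup>2" for x y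
    using sum_squares_bound[of "cmod x" "cmod y"] mult_nonneg_nonneg[of "cmod x" "cmod y"]
      norm_ge_zero[of x] norm_ge_zero[of y] by linarith
  then show "AE b in M. norm (cnj (f b) * g b) \<le> norm ((cmod (f b))\<^sup>2 + (cmod (g b))\<^sup>2)"
    by (simp add: norm_mult)
qed simp

lemma AE_tendsto_of_summable_differences:
  fixes f :: "nat \<Rightarrow> 'b \<Rightarrow> complex"
  assumes f: "\<And>n. f n \<in> square_integrable M"
    and small: "\<And>j. (\<integral>b. (cmod (f (Suc j) b - f j b))\<^sup>2 \<partial>M) \<le> (1/4) ^ j"
  shows "AE b in M. convergent (\<lambda>n. f n b)"
proof -
  note [measurable] = square_integrable_measurable[OF f]
  let ?d = "\<lambda>j b. f (Suc j) b - f j b"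
  \<comment> \<open>The weights \<open>2\<^sup>j\<close> leave the series integrable and, by AM-GM
    \<open>2 \<bar>d\<bar> \<le> 2\<^sup>-\<^sup>j + 2\<^sup>j \<bar>d\<bar>\<^sup>2\<close>, control the differences themselves.\<close>
  have "(\<integral>\<^sup>+ b. (\<Sum>j. ennreal (2 ^ j * (cmod (?d j b))\<^sup>2)) \<partial>M)
      = (\<Sum>j. \<integral>\<^sup>+ b. ennreal (2 ^ j * (cmod (?d j b))\<^sup>2) \<partial>M)"
    by (intro nn_integral_suminf) simp
  also have "\<dots> \<le> (\<Sum>j. ennreal ((1/2) ^ j))"
  proof (rule suminf_le)
    fix j
    have "integrable M (\<lambda>b. (cmod (?d j b))\<^sup>2)"
      by (intro square_integrable_integrable square_integrable_diff f)
    then have "(\<integral>\<^sup>+ b. ennreal (2 ^ j * (cmod (?d j b))\<^sup>2) \<partial>M)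
        = ennreal (2 ^ j * (\<integral>b. (cmod (?d j b))\<^sup>2 \<partial>M))"
      by (subst nn_integral_eq_integral) auto
    also have "\<dots> \<le> ennreal (2 ^ j * (1/4) ^ j)"
      using small by (intro ennreal_leI mult_left_mono) auto
    also have "2 ^ j * (1/4) ^ j = (1/2 :: real) ^ j"
      by (simp add: power_mult_distrib[symmetric])
    finally show "(\<integral>\<^sup>+ b. ennreal (2 ^ j * (cmod (?d j b))\<^sup>2) \<partial>M) \<le> ennreal ((1/2) ^ j)" .
  qed auto
  also have "\<dots> < \<infinity>"
    by (subst suminf_ennreal2) (auto intro: summable_geometric)
  finally have "AE b in M. (\<Sum>j. ennreal (2 ^ j * (cmod (?d j b))\<^sup>2)) \<noteq> \<infinity>"
    by (intro nn_integral_PInf_AE) auto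
  then show ?thesis
  proof (rule AE_mp, intro AE_I2 impI)
    fix b assume "(\<Sum>j. ennreal (2 ^ j * (cmod (?d j b))\<^sup>2)) \<noteq> \<infinity>"
    then have "summable (\<lambda>j. 2 ^ j * (cmod (?d j b))\<^sup>2)"
      by (intro summable_suminf_not_top) auto
    then have "summable (\<lambda>j. (1/2) ^ j + 2 ^ j * (cmod (?d j b))\<^sup>2)"
      by (intro summable_add summable_geometric) auto
    then have "summable (\<lambda>j. ?d j b)"
    proof (rule summable_comparison_test'[where N = 0])
      fix j
      let ?p = "2 ^ j :: real" and ?x = "cmod (?d j b)"
      have "0 \<le> (?p * ?x - 1)\<^sup>2" by simp
      also have "\<dots> = ?p * (?p * ?x\<^sup>2 + 1 / ?p - 2 * ?x)"
        by (simp add: power2_eq_square algebra_simps)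
      finally have "0 \<le> ?p * (?p * ?x\<^sup>2 + 1 / ?p - 2 * ?x)" .
      then have "0 \<le> ?p * ?x\<^sup>2 + 1 / ?p - 2 * ?x"
        by (intro mult_left_le_imp_le[of ?p 0]) simp_all
      then show "?x \<le> (1/2) ^ j + ?p * ?x\<^sup>2"
        using norm_ge_zero[of "?d j b"] unfolding power_one_over by linarith
    qed
    then have "(\<lambda>n. \<Sum>j<n. ?d j b) \<longlonglongrightarrow> (\<Sum>j. ?d j b)" by (rule summable_LIMSEQ)
    then have "(\<lambda>n. f n b - f 0 b) \<longlonglongrightarrow> (\<Sum>j. ?d j b)"
      by (simp add: sum_lessThan_telescope[of "\<lambda>j. f j b"])
    then show "convergent (\<lambda>n. f n b)"
      using convergentI convergent_diff_const_right_iff by blast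
  qed
qed

theorem Riesz_Fischer:
  fixes f :: "nat \<Rightarrow> 'b \<Rightarrow> complex"
  assumes f: "\<And>n. f n \<in> square_integrable M"
    and Cauchy: "\<And>e. 0 < e \<Longrightarrow> \<exists>N. \<forall>m\<ge>N. \<forall>n\<ge>N. (\<integral>b. (cmod (f m b - f n b))\<^sup>2 \<partial>M) < e"
  obtains g where "g \<in> square_integrable M" "(\<lambda>n. \<integral>b. (cmod (f n b - g b))\<^sup>2 \<partial>M) \<longlonglongrightarrow> 0"
proof -
  note [measurable] = square_integrable_measurable[OF f]
  have "\<forall>j. \<exists>N. \<forall>m\<ge>N. \<forall>n\<ge>N. (\<integral>b. (cmod (f m b - f n b))\<^sup>2 \<partial>M) < (1/4) ^ j"
    using Cauchy by simp
  then obtain N where N: "\<And>j m n. \<lbrakk>m \<ge> N j; n \<ge> N j\<rbrakk>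
      \<Longrightarrow> (\<integral>b. (cmod (f m b - f n b))\<^sup>2 \<partial>M) < (1/4) ^ j"
    by metis
  define r where "r j = j + (\<Sum>i\<le>j. N i)" for j
  have r: "N j \<le> r j" "N j \<le> r (Suc j)" "j \<le> r j" for j
  proof -
    have "N j \<le> sum N {..j}" by (rule member_le_sum) auto
    then show "N j \<le> r j" "N j \<le> r (Suc j)" "j \<le> r j" by (simp_all add: r_def)
  qed
  define g where "g b = lim (\<lambda>j. f (r j) b)" for b
  have [measurable]: "g \<in> borel_measurable M" unfolding g_def by measurable
  have "AE b in M. convergent (\<lambda>j. f (r j) b)"
    using N r f by (intro AE_tendsto_of_summable_differences) (auto intro: less_imp_le)
  then have lim: "AE b in M. (\<lambda>j. f (r j) b) \<longlonglongrightarrow> g b"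
    by (simp add: convergent_LIMSEQ_iff g_def)
  have bound: "\<exists>N. \<forall>m\<ge>N. (\<integral>\<^sup>+ b. ennreal ((cmod (f m b - g b))\<^sup>2) \<partial>M) \<le> ennreal e"
    if e: "e > 0" for e
  proof -
    obtain K where K: "\<And>m n. \<lbrakk>m \<ge> K; n \<ge> K\<rbrakk> \<Longrightarrow> (\<integral>b. (cmod (f m b - f n b))\<^sup>2 \<partial>M) < e"
      using Cauchy[OF e] by metis
    have "(\<integral>\<^sup>+ b. ennreal ((cmod (f m b - g b))\<^sup>2) \<partial>M) \<le> ennreal e" if m: "m \<ge> K" for m
    proof -
      have "(\<integral>\<^sup>+ b. ennreal ((cmod (f m b - g b))\<^sup>2) \<partial>M)
          = (\<integral>\<^sup>+ b. liminf (\<lambda>j. ennreal ((cmod (f m b - f (r j) b))\<^sup>2)) \<partial>M)"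
      proof (rule nn_integral_cong_AE, use lim in eventually_elim)
        case (elim b)
        then have "(\<lambda>j. ennreal ((cmod (f m b - f (r j) b))\<^sup>2)) \<longlonglongrightarrow> ennreal ((cmod (f m b - g b))\<^sup>2)"
          by (intro tendsto_intros)
        then show ?case by (intro lim_imp_Liminf[symmetric]) auto
      qed
      also have "\<dots> \<le> liminf (\<lambda>j. \<integral>\<^sup>+ b. ennreal ((cmod (f m b - f (r j) b))\<^sup>2) \<partial>M)"
        by (intro nn_integral_liminf) simp
      also have "\<dots> \<le> liminf (\<lambda>j. ennreal e)"
      proof (rule Liminf_mono)
        have "(\<integral>\<^sup>+ b. ennreal ((cmod (f m b - f (r j) b))\<^sup>2) \<partial>M) \<le> ennreal e" if j: "j \<ge> K" for j
        proof -
          have "integrable M (\<lambda>b. (cmod (f m b - f (r j) b))\<^sup>2)"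
            by (intro square_integrable_integrable square_integrable_diff f)
          then have "(\<integral>\<^sup>+ b. ennreal ((cmod (f m b - f (r j) b))\<^sup>2) \<partial>M)
              = ennreal (\<integral>b. (cmod (f m b - f (r j) b))\<^sup>2 \<partial>M)"
            by (intro nn_integral_eq_integral) auto
          also have "\<dots> \<le> ennreal e"
            using K[OF m order_trans[OF j r(3)]] by (intro ennreal_leI) simp
          finally show ?thesis .
        qed
        then show "\<forall>\<^sub>F j in sequentially.
            (\<integral>\<^sup>+ b. ennreal ((cmod (f m b - f (r j) b))\<^sup>2) \<partial>M) \<le> ennreal e"
          by (auto simp: eventually_sequentially)
      qed
      also have "\<dots> = ennreal e" by (simp add: Liminf_const)
      finally show ?thesis .
    qed
    then show ?thesis by blast
  qed
  obtain m where m: "(\<integral>\<^sup>+ b. ennreal ((cmod (f m b - g b))\<^sup>2) \<partial>M) \<le> ennreal 1"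
    using bound[of 1] by auto
  have "(\<lambda>b. f m b - g b) \<in> square_integrable M"
    unfolding square_integrable_def
    using le_less_trans[OF m ennreal_less_top] by (auto intro!: integrableI_bounded)
  from square_integrable_diff[OF f[of m] this] have g: "g \<in> square_integrable M" by simp
  have "(\<lambda>n. \<integral>b. (cmod (f n b - g b))\<^sup>2 \<partial>M) \<longlonglongrightarrow> 0"
  proof (rule LIMSEQ_I)
    fix e :: real assume e: "e > 0"
    then obtain N where N: "\<And>m. m \<ge> N
        \<Longrightarrow> (\<integral>\<^sup>+ b. ennreal ((cmod (f m b - g b))\<^sup>2) \<partial>M) \<le> ennreal (e / 2)"
      using bound[of "e / 2"] by auto
    have "(\<integral>b. (cmod (f m b - g b))\<^sup>2 \<partial>M) \<le> e / 2" if "m \<ge> N" for m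
    proof -
      have "integrable M (\<lambda>b. (cmod (f m b - g b))\<^sup>2)"
        by (intro square_integrable_integrable square_integrable_diff f g)
      then have "ennreal (\<integral>b. (cmod (f m b - g b))\<^sup>2 \<partial>M) \<le> ennreal (e / 2)"
        using N[OF that] by (subst (asm) nn_integral_eq_integral) auto
      then show ?thesis using e by (simp add: ennreal_le_iff)
    qed
    then show "\<exists>no. \<forall>n\<ge>no. norm ((\<integral>b. (cmod (f n b - g b))\<^sup>2 \<partial>M) - 0) < e"
      using e by (intro exI[of _ N]) (auto intro: le_less_trans[of _ "e / 2"])
  qed
  with g show ?thesis using that by blast
qed

lemma L2_simps:
  "vec (L2 M) = L2_class M ` square_integrable M"
  "vzero (L2 M) = L2_class M (\<lambda>b. 0)"
  by (simp_all add: L2_def)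

lemma L2_class_in_vec: "f \<in> square_integrable M \<Longrightarrow> L2_class M f \<in> vec (L2 M)"
  by (simp add: L2_simps)

lemma L2_class_cong:
  assumes "AE b in M. f b = g b"
  shows "L2_class M f = L2_class M g"
  unfolding L2_class_def using assms by (auto elim: AE_mp)

lemma rep_L2_class:
  assumes "f \<in> square_integrable M"
  shows "rep (L2_class M f) \<in> square_integrable M" "AE b in M. rep (L2_class M f) b = f b"
proof -
  have "f \<in> L2_class M f" using assms by (simp add: L2_class_def)
  then have "rep (L2_class M f) \<in> L2_class M f"
    unfolding rep_def by (rule someI[where P = "\<lambda>h. h \<in> L2_class M f"])
  then show "rep (L2_class M f) \<in> square_integrable M" "AE b in M. rep (L2_class M f) b = f b"
    by (auto simp: L2_class_def)
qed

lemma L2_vec_rep: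
  assumes "\<Phi> \<in> vec (L2 M)"
  shows "rep \<Phi> \<in> square_integrable M" "L2_class M (rep \<Phi>) = \<Phi>"
proof -
  obtain f where f: "f \<in> square_integrable M" "\<Phi> = L2_class M f" using assms by (auto simp: L2_simps)
  show "rep \<Phi> \<in> square_integrable M" "L2_class M (rep \<Phi>) = \<Phi>"
    using rep_L2_class[OF f(1)] L2_class_cong unfolding f(2) by auto
qed

lemma L2_add_class:
  assumes "f \<in> square_integrable M" "g \<in> square_integrable M"
  shows "vadd (L2 M) (L2_class M f) (L2_class M g) = L2_class M (\<lambda>b. f b + g b)"
  using rep_L2_class(2)[OF assms(1)] rep_L2_class(2)[OF assms(2)]
  by (auto simp: L2_def intro!: L2_class_cong elim: AE_mp)

lemma L2_scale_class:
  assumes "f \<in> square_integrable M"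
  shows "vscale (L2 M) a (L2_class M f) = L2_class M (\<lambda>b. a * f b)"
  using rep_L2_class(2)[OF assms]
  by (auto simp: L2_def intro!: L2_class_cong elim: AE_mp)

lemma L2_inner_class:
  assumes [measurable]: "f \<in> square_integrable M" "g \<in> square_integrable M"
  shows "vinner (L2 M) (L2_class M f) (L2_class M g) = (\<integral>b. cnj (f b) * g b \<partial>M)"
proof -
  note [measurable] = rep_L2_class(1)[OF assms(1)] rep_L2_class(1)[OF assms(2)]
  have "(\<integral>b. cnj (rep (L2_class M f) b) * rep (L2_class M g) b \<partial>M) = (\<integral>b. cnj (f b) * g b \<partial>M)"
    by (rule integral_cong_AE) (use rep_L2_class(2)[OF assms(1)] rep_L2_class(2)[OF assms(2)] in
        \<open>auto elim: AE_mp\<close>)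
  then show ?thesis by (simp add: L2_def)
qed

lemma L2_norm_class:
  assumes "f \<in> square_integrable M"
  shows "(vnorm (L2 M) (L2_class M f))\<^sup>2 = (\<integral>b. (cmod (f b))\<^sup>2 \<partial>M)"
    and "vinner (L2 M) (L2_class M f) (L2_class M f) = of_real (\<integral>b. (cmod (f b))\<^sup>2 \<partial>M)"
proof -
  have "vinner (L2 M) (L2_class M f) (L2_class M f) = (\<integral>b. complex_of_real ((cmod (f b))\<^sup>2) \<partial>M)"
    using assms by (simp only: L2_inner_class complex_norm_square mult.commute)
  then show "vinner (L2 M) (L2_class M f) (L2_class M f) = of_real (\<integral>b. (cmod (f b))\<^sup>2 \<partial>M)"
    by (simp only: integral_complex_of_real)
  then show "(vnorm (L2 M) (L2_class M f))\<^sup>2 = (\<integral>b. (cmod (f b))\<^sup>2 \<partial>M)"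
    by (simp add: vnorm_def)
qed

lemma L2_diff_class:
  assumes "f \<in> square_integrable M" "g \<in> square_integrable M"
  shows "vdiff (L2 M) (L2_class M f) (L2_class M g) = L2_class M (\<lambda>b. f b - g b)"
  using assms by (simp add: vdiff_def L2_scale_class L2_add_class square_integrable_uminus)

lemmas L2_class_simps = L2_add_class L2_scale_class L2_inner_class
  square_integrable_add square_integrable_scale square_integrable_uminus square_integrable_zero

theorem hilbert_space_L2: "hilbert_space (L2 M)"
proof
  fix u v w :: "('a \<Rightarrow> complex) set" and a b :: complex
  show "vzero (L2 M) \<in> vec (L2 M)" by (simp add: L2_simps square_integrable_zero)
  assume "u \<in> vec (L2 M)"
  then obtain f where f: "f \<in> square_integrable M" "u = L2_class M f" by (auto simp: L2_simps)
  show "vscale (L2 M) a u \<in> vec (L2 M)"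
    using f by (simp add: L2_class_simps L2_class_in_vec)
  show "vadd (L2 M) u (vzero (L2 M)) = u"
    using f by (simp add: L2_class_simps L2_simps)
  show "vadd (L2 M) u (vscale (L2 M) (- 1) u) = vzero (L2 M)"
    using f by (simp add: L2_class_simps L2_simps)
  show "vscale (L2 M) 1 u = u"
    using f by (simp add: L2_class_simps)
  show "vscale (L2 M) a (vscale (L2 M) b u) = vscale (L2 M) (a * b) u"
    using f by (simp add: L2_class_simps mult.assoc)
  show "vscale (L2 M) (a + b) u = vadd (L2 M) (vscale (L2 M) a u) (vscale (L2 M) b u)"
    using f by (simp add: L2_class_simps distrib_right)
  show "0 \<le> vinner (L2 M) u u"
    using f by (simp add: L2_norm_class(2) less_eq_complex_def)
  show "u = vzero (L2 M)" if "vinner (L2 M) u u = 0"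
  proof -
    have "(\<integral>b. (cmod (f b))\<^sup>2 \<partial>M) = 0"
      using that f by (simp add: L2_norm_class(2) del: of_real_power)
    then have "AE b in M. (cmod (f b))\<^sup>2 = 0"
      using integral_nonneg_eq_0_iff_AE[OF square_integrable_integrable[OF f(1)]] by simp
    then show ?thesis using f by (auto simp: L2_simps intro!: L2_class_cong)
  qed
  assume "v \<in> vec (L2 M)"
  then obtain g where g: "g \<in> square_integrable M" "v = L2_class M g" by (auto simp: L2_simps)
  show "vadd (L2 M) u v \<in> vec (L2 M)"
    using f g by (simp add: L2_class_simps L2_class_in_vec)
  show "vadd (L2 M) u v = vadd (L2 M) v u"
    using f g by (simp add: L2_class_simps add.commute)
  show "vscale (L2 M) a (vadd (L2 M) u v) = vadd (L2 M) (vscale (L2 M) a u) (vscale (L2 M) a v)"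
    using f g by (simp add: L2_class_simps distrib_left)
  have "(\<integral>b. cnj (f b) * g b \<partial>M) = (\<integral>b. cnj (cnj (g b) * f b) \<partial>M)"
    by (simp add: mult.commute)
  then show "vinner (L2 M) u v = cnj (vinner (L2 M) v u)"
    using f g by (simp add: L2_class_simps del: complex_cnj_mult)
  show "vinner (L2 M) u (vscale (L2 M) a v) = a * vinner (L2 M) u v"
    using f g by (simp add: L2_class_simps mult.left_commute[of _ a])
  assume "w \<in> vec (L2 M)"
  then obtain h where h: "h \<in> square_integrable M" "w = L2_class M h" by (auto simp: L2_simps)
  show "vadd (L2 M) (vadd (L2 M) u v) w = vadd (L2 M) u (vadd (L2 M) v w)"
    using f g h by (simp add: L2_class_simps add.assoc)
  show "vinner (L2 M) u (vadd (L2 M) v w) = vinner (L2 M) u v + vinner (L2 M) u w"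
    using f g h by (simp add: L2_class_simps distrib_left integrable_cnj_mult)
next
  fix s :: "nat \<Rightarrow> ('a \<Rightarrow> complex) set"
  assume s: "\<And>n. s n \<in> vec (L2 M)" and Cauchy: "vCauchy (L2 M) s"
  define f where "f n = rep (s n)" for n
  have f: "f n \<in> square_integrable M" "s n = L2_class M (f n)" for n
    using L2_vec_rep[OF s] by (simp_all add: f_def)
  have dist: "vnorm (L2 M) (vdiff (L2 M) (s n) (L2_class M g))
      = sqrt (\<integral>b. (cmod (f n b - g b))\<^sup>2 \<partial>M)" if "g \<in> square_integrable M" for n g
    using that f by (simp add: L2_diff_class square_integrable_diff vnorm_def L2_norm_class(2)
        del: of_real_power)
  obtain g where g: "g \<in> square_integrable M"
    "(\<lambda>n. \<integral>b. (cmod (f n b - g b))\<^sup>2 \<partial>M) \<longlonglongrightarrow> 0"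
  proof (rule Riesz_Fischer[of f M])
    fix e :: real assume "e > 0"
    then obtain N where "\<forall>m\<ge>N. \<forall>n\<ge>N. vnorm (L2 M) (vdiff (L2 M) (s m) (s n)) < sqrt e"
      using Cauchy unfolding vCauchy_def by (meson real_sqrt_gt_zero)
    then show "\<exists>N. \<forall>m\<ge>N. \<forall>n\<ge>N. (\<integral>b. (cmod (f m b - f n b))\<^sup>2 \<partial>M) < e"
      using dist[OF f(1)] by (auto simp: f(2)[symmetric])
  qed (use f in auto)
  have "vlim (L2 M) s (L2_class M g)"
    unfolding vlim_def dist[OF g(1)] using tendsto_real_sqrt[OF g(2)] by simp
  then show "\<exists>u\<in>vec (L2 M). vlim (L2 M) s u"
    using g L2_class_in_vec by blast
qed

section \<open>The operators between the RKHS and \<open>L\<^sup>2\<close>\<close>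

lemma T_assignment_finite_sets:
  "T_assignment K M k = {(\<lambda>y. \<Sum>x\<in>F. c x * K y x, L2_class M (\<lambda>b. \<Sum>x\<in>F. c x * k x b)) |
     F c. finite F}" (is "_ = ?R")
proof
  show "T_assignment K M k \<subseteq> ?R"
  proof (clarsimp simp only: T_assignment_def)
    fix n :: nat and c :: "nat \<Rightarrow> complex" and x :: "nat \<Rightarrow> 'a"
    define c' where "c' z = (\<Sum>i\<in>{i. i \<in> {..<n} \<and> x i = z}. c i)" for z
    have eq: "(\<Sum>i<n. c i * h (x i)) = (\<Sum>z\<in>x ` {..<n}. c' z * h z)" for h :: "'a \<Rightarrow> complex"
      by (subst sum.image_gen[of _ _ x]) (auto simp: c'_def sum_distrib_right intro!: sum.cong)
    have "(\<lambda>y. \<Sum>i<n. c i * K y (x i)) = (\<lambda>y. \<Sum>z\<in>x ` {..<n}. c' z * K y z)"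
      by (rule ext) (rule eq)
    moreover have "(\<lambda>b. \<Sum>i<n. c i * k (x i) b) = (\<lambda>b. \<Sum>z\<in>x ` {..<n}. c' z * k z b)"
    proof
      fix b show "(\<Sum>i<n. c i * k (x i) b) = (\<Sum>z\<in>x ` {..<n}. c' z * k z b)"
        by (rule eq[of "\<lambda>z. k z b"])
    qed
    moreover have "finite (x ` {..<n})" by simp
    ultimately show "\<exists>F c'. (\<lambda>y. \<Sum>i<n. c i * K y (x i), L2_class M (\<lambda>b. \<Sum>i<n. c i * k (x i) b))
        = (\<lambda>y. \<Sum>z\<in>F. c' z * K y z, L2_class M (\<lambda>b. \<Sum>z\<in>F. c' z * k z b)) \<and> finite F"
      by metis
  qed
  show "?R \<subseteq> T_assignment K M k"
  proof
    fix p assume "p \<in> ?R"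
    then obtain F c where F: "finite F"
      and p: "p = (\<lambda>y. \<Sum>x\<in>F. c x * K y x, L2_class M (\<lambda>b. \<Sum>x\<in>F. c x * k x b))" by blast
    obtain x where "bij_betw x {0..<card F} F" using ex_bij_betw_nat_finite[OF F] by blast
    then have eq: "(\<Sum>z\<in>F. c z * h z) = (\<Sum>i<card F. c (x i) * h (x i))" for h
      using sum.reindex_bij_betw[of x "{0..<card F}" F "\<lambda>z. c z * h z"] by (simp add: atLeast0LessThan)
    show "p \<in> T_assignment K M k"
      unfolding p eq T_assignment_def
      by (rule CollectI, rule exI[of _ "card F"], rule exI[of _ "\<lambda>i. c (x i)"], rule exI[of _ x]) simp
  qed
qed

context rkhs
begin

lemma kernel_sum_in_vec:
  "finite F \<Longrightarrow> (\<lambda>y. \<Sum>x\<in>F. c x * K y x) \<in> vec H"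
proof (induction F rule: finite_induct)
  case empty
  show ?case using zero_closed by (simp add: zero_pointwise)
next
  case (insert x F)
  show ?case
    using add_closed[OF scale_closed[OF kernel_section, of "c x" x] insert.IH] insert.hyps
    by (simp add: add_pointwise scale_pointwise)
qed

lemma inner_kernel_sum:
  assumes "h \<in> vec H"
  shows "finite F \<Longrightarrow> vinner H (\<lambda>y. \<Sum>x\<in>F. c x * K y x) h = (\<Sum>x\<in>F. cnj (c x) * h x)"
proof (induction F rule: finite_induct)
  case empty
  show ?case using inner_zero_left[OF assms] by (simp add: zero_pointwise)
next
  case (insert x F)
  have "vinner H (\<lambda>y. c x * K y x + (\<Sum>x\<in>F. c x * K y x)) h
      = cnj (c x) * h x + vinner H (\<lambda>y. \<Sum>x\<in>F. c x * K y x) h"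
    using inner_add_left[OF scale_closed[OF kernel_section, of "c x" x]
        kernel_sum_in_vec[OF insert.hyps(1)] assms]
      inner_scale_left[OF kernel_section assms] reproducing[OF assms, of x]
    by (simp add: add_pointwise scale_pointwise)
  then show ?case using insert by simp
qed

end

locale rkhs_L2_family = rkhs K H
  for K :: "'x \<Rightarrow> 'x \<Rightarrow> complex" and H :: "('x \<Rightarrow> complex) hspace" +
  fixes M :: "'b measure" and k :: "'x \<Rightarrow> 'b \<Rightarrow> complex"
  assumes k_square_integrable: "k x \<in> square_integrable M"
begin

sublocale L2: hilbert_space "L2 M"
  by (rule hilbert_space_L2)

lemma family_sum_square_integrable: "(\<lambda>b. \<Sum>x\<in>F. c x * k x b) \<in> square_integrable M"
  by (intro square_integrable_sum square_integrable_scale k_square_integrable)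

lemma S_B_eq_inner: "\<Phi> \<in> vec (L2 M) \<Longrightarrow> S_B M k \<Phi> x = vinner (L2 M) (L2_class M (k x)) \<Phi>"
  using L2_inner_class[OF k_square_integrable, of "rep \<Phi>"] L2_vec_rep[of \<Phi> M]
  by (simp add: S_B_def)

lemma inner_family_sum:
  assumes "\<Phi> \<in> vec (L2 M)"
  shows "vinner (L2 M) (L2_class M (\<lambda>b. \<Sum>x\<in>F. c x * k x b)) \<Phi> = (\<Sum>x\<in>F. cnj (c x) * S_B M k \<Phi> x)"
proof -
  note rep = L2_vec_rep[OF assms]
  have "vinner (L2 M) (L2_class M (\<lambda>b. \<Sum>x\<in>F. c x * k x b)) \<Phi>
      = (\<integral>b. (\<Sum>x\<in>F. cnj (c x) * (cnj (k x b) * rep \<Phi> b)) \<partial>M)"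
    using L2_inner_class[OF family_sum_square_integrable rep(1)]
    by (simp add: rep(2) sum_distrib_right mult.assoc)
  also have "\<dots> = (\<Sum>x\<in>F. cnj (c x) * S_B M k \<Phi> x)"
    by (simp add: Bochner_Integration.integral_sum integrable_cnj_mult k_square_integrable rep S_B_def)
  finally show ?thesis .
qed

lemma T_assignment_subset: "T_assignment K M k \<subseteq> vec H \<times> vec (L2 M)"
  by (auto simp: T_assignment_finite_sets kernel_sum_in_vec
      intro!: L2_class_in_vec family_sum_square_integrable)

lemma kernel_section_assignment: "(\<lambda>y. K y x, L2_class M (k x)) \<in> T_assignment K M k"
  by (auto simp: T_assignment_finite_sets intro!: exI[of _ "{x}"] exI[of _ "\<lambda>_. 1"])

lemma inner_T_assignment:
  assumes "(u, w) \<in> T_assignment K M k" "\<Phi> \<in> vec (L2 M)" "S_B M k \<Phi> \<in> vec H"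
  shows "vinner (L2 M) w \<Phi> = vinner H u (S_B M k \<Phi>)"
  using assms by (auto simp: T_assignment_finite_sets inner_kernel_sum inner_family_sum)

lemma T_assignment_add:
  assumes "(u, w) \<in> T_assignment K M k" "(v, z) \<in> T_assignment K M k"
  shows "(vadd H u v, vadd (L2 M) w z) \<in> T_assignment K M k"
proof -
  obtain F c where F: "finite F" "u = (\<lambda>y. \<Sum>x\<in>F. c x * K y x)"
    "w = L2_class M (\<lambda>b. \<Sum>x\<in>F. c x * k x b)"
    using assms(1) unfolding T_assignment_finite_sets by blast
  obtain G d where G: "finite G" "v = (\<lambda>y. \<Sum>x\<in>G. d x * K y x)"
    "z = L2_class M (\<lambda>b. \<Sum>x\<in>G. d x * k x b)"
    using assms(2) unfolding T_assignment_finite_sets by blast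
  define e where "e x = (if x \<in> F then c x else 0) + (if x \<in> G then d x else 0)" for x
  have e: "(\<Sum>x\<in>F. c x * h x) + (\<Sum>x\<in>G. d x * h x) = (\<Sum>x\<in>F \<union> G. e x * h x)" for h
  proof -
    have "(\<Sum>x\<in>F. c x * h x) = (\<Sum>x\<in>F \<union> G. (if x \<in> F then c x else 0) * h x)"
      "(\<Sum>x\<in>G. d x * h x) = (\<Sum>x\<in>F \<union> G. (if x \<in> G then d x else 0) * h x)"
      using F(1) G(1) by (intro sum.mono_neutral_cong_left; auto)+
    then show ?thesis by (simp add: e_def distrib_right sum.distrib)
  qed
  have "vadd H u v = (\<lambda>y. \<Sum>x\<in>F \<union> G. e x * K y x)"
    by (simp add: add_pointwise F(2) G(2) e)
  moreover have "vadd (L2 M) w z = L2_class M (\<lambda>b. \<Sum>x\<in>F \<union> G. e x * k x b)"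
    by (simp add: F(3) G(3) L2_add_class family_sum_square_integrable e)
  ultimately show ?thesis
    unfolding T_assignment_finite_sets using F(1) G(1) by blast
qed

lemma T_assignment_scale:
  assumes "(u, w) \<in> T_assignment K M k"
  shows "(vscale H a u, vscale (L2 M) a w) \<in> T_assignment K M k"
proof -
  obtain F c where F: "finite F" "u = (\<lambda>y. \<Sum>x\<in>F. c x * K y x)"
    "w = L2_class M (\<lambda>b. \<Sum>x\<in>F. c x * k x b)"
    using assms(1) unfolding T_assignment_finite_sets by blast
  have "vscale H a u = (\<lambda>y. \<Sum>x\<in>F. (a * c x) * K y x)"
    by (simp add: scale_pointwise F(2) sum_distrib_left mult.assoc)
  moreover have "vscale (L2 M) a w = L2_class M (\<lambda>b. \<Sum>x\<in>F. (a * c x) * k x b)"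
    by (simp add: F(3) L2_scale_class family_sum_square_integrable sum_distrib_left mult.assoc)
  ultimately show ?thesis
    unfolding T_assignment_finite_sets using F(1) by (auto intro!: exI[of _ F] exI[of _ "\<lambda>x. a * c x"])
qed

lemma T_assignment_dense:
  assumes "u \<in> vec H"
  shows "\<exists>s. (\<forall>n. s n \<in> Domain (T_assignment K M k)) \<and> vlim H s u"
proof (rule dense_if_orthogonal_trivial[of "Domain (T_assignment K M k)" u])
  show "Domain (T_assignment K M k) \<subseteq> vec H" using T_assignment_subset by auto
  have "(vzero H, L2_class M (\<lambda>b. 0)) \<in> T_assignment K M k"
    by (auto simp: T_assignment_finite_sets zero_pointwise intro!: exI[of _ "{}"])
  then show "vzero H \<in> Domain (T_assignment K M k)" by blast
  show "v = vzero H" if v: "v \<in> vec H"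
    and orth: "\<And>d. d \<in> Domain (T_assignment K M k) \<Longrightarrow> vinner H d v = 0" for v
    unfolding zero_pointwise
  proof
    fix x
    show "v x = 0"
      unfolding reproducing[OF v, of x] by (rule orth) (use kernel_section_assignment in blast)
  qed
qed (use assms in \<open>auto intro: T_assignment_add T_assignment_scale\<close>)

lemma kernel_le_iff_contraction:
  "K_mu M k \<lless> K \<longleftrightarrow> (\<forall>(u, w)\<in>T_assignment K M k. vnorm (L2 M) w \<le> vnorm H u)"
proof -
  have "(\<Sum>x\<in>F. \<Sum>y\<in>F. cnj (c x) * c y * K_mu M k x y) \<le> (\<Sum>x\<in>F. \<Sum>y\<in>F. cnj (c x) * c y * K x y)
      \<longleftrightarrow> vnorm (L2 M) (L2_class M (\<lambda>b. \<Sum>x\<in>F. c x * k x b)) \<le> vnorm H (\<lambda>y. \<Sum>x\<in>F. c x * K y x)"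
    (is "?A \<le> ?B \<longleftrightarrow> vnorm _ ?w \<le> vnorm _ ?u") if F: "finite F" for F c
  proof -
    note u = kernel_sum_in_vec[OF F, of c]
    note w = L2_class_in_vec[OF family_sum_square_integrable, of c F]
    have "S_B M k ?w x = (\<Sum>y\<in>F. c y * K_mu M k x y)" for x
    proof -
      have "S_B M k ?w x = (\<integral>b. (\<Sum>y\<in>F. c y * (cnj (k x b) * k y b)) \<partial>M)"
        unfolding S_B_eq_inner[OF w] L2_inner_class[OF k_square_integrable family_sum_square_integrable]
        by (simp add: sum_distrib_left mult.left_commute)
      then show ?thesis
        by (simp add: Bochner_Integration.integral_sum integrable_cnj_mult k_square_integrable K_mu_def)
    qed
    then have "?A = vinner (L2 M) ?w ?w"
      unfolding inner_family_sum[OF w] by (simp add: sum_distrib_left mult.assoc)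
    moreover have "?B = vinner H ?u ?u"
      unfolding inner_kernel_sum[OF u F] by (simp add: sum_distrib_left mult.assoc)
    ultimately have "?A \<le> ?B \<longleftrightarrow> (vnorm (L2 M) ?w)\<^sup>2 \<le> (vnorm H ?u)\<^sup>2"
      unfolding inner_self[OF u] L2.inner_self[OF w] by (simp add: less_eq_complex_def)
    also have "\<dots> \<longleftrightarrow> vnorm (L2 M) ?w \<le> vnorm H ?u"
      using norm_nonneg[OF u] L2.norm_nonneg[OF w] by (simp add: power_mono_iff)
    finally show ?thesis .
  qed
  then show ?thesis
    unfolding kernel_le_def T_assignment_finite_sets by (auto; blast)
qed

lemma T_B_contractive:
  assumes "K_mu M k \<lless> K"
  shows "well_defined_on (vec H) (T_graph K H M k)" "contractive_operator H (L2 M) (T_B K H M k)"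
proof -
  have "vnorm (L2 M) w \<le> vnorm H u" if "(u, w) \<in> T_assignment K M k" for u w
    using assms that unfolding kernel_le_iff_contraction by blast
  note closure = norm_closure_of_contraction[OF hilbert_space_axioms L2.hilbert_space_axioms
      T_assignment_subset T_assignment_add T_assignment_scale this T_assignment_dense]
  show "well_defined_on (vec H) (T_graph K H M k)"
    unfolding T_graph_def by (rule closure(1))
  show "contractive_operator H (L2 M) (T_B K H M k)"
    unfolding T_graph_def T_B_def by (rule closure(2))
qed

lemma T_B_assignment:
  assumes "well_defined_on (vec H) (T_graph K H M k)" and uw: "(u, w) \<in> T_assignment K M k"
  shows "T_B K H M k u = w"
proof -
  have u: "u \<in> vec H" and w: "w \<in> vec (L2 M)" using uw T_assignment_subset by auto
  have "(u, w) \<in> T_graph K H M k"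
    unfolding T_graph_def norm_closure_def using u w uw vlim_const[OF u] L2.vlim_const[OF w]
    by (auto intro!: exI[of _ "\<lambda>_. u"] exI[of _ "\<lambda>_. w"])
  moreover have "\<exists>!w. (u, w) \<in> T_graph K H M k"
    using assms(1) u unfolding well_defined_on_def by (rule bspec)
  ultimately show ?thesis
    unfolding T_B_def operator_of_def by (intro the1_equality)
qed

lemma kernel_le_if_T_B_contractive:
  assumes "well_defined_on (vec H) (T_graph K H M k)" "contractive_operator H (L2 M) (T_B K H M k)"
  shows "K_mu M k \<lless> K"
  unfolding kernel_le_iff_contraction
proof clarify
  fix u w assume uw: "(u, w) \<in> T_assignment K M k"
  then have "u \<in> vec H" using T_assignment_subset by auto
  then show "vnorm (L2 M) w \<le> vnorm H u"
    using assms(2) unfolding contractive_operator_def T_B_assignment[OF assms(1) uw, symmetric] by blast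
qed

lemma kernel_le_if_S_B_contractive:
  assumes S: "contractive_operator (L2 M) H (S_B M k)"
  shows "K_mu M k \<lless> K"
  unfolding kernel_le_iff_contraction
proof clarify
  fix u w assume uw: "(u, w) \<in> T_assignment K M k"
  then have u: "u \<in> vec H" and w: "w \<in> vec (L2 M)" using T_assignment_subset by auto
  have Sw: "S_B M k w \<in> vec H" "vnorm H (S_B M k w) \<le> vnorm (L2 M) w"
    using S w unfolding contractive_operator_def linear_operator_def by auto
  have "(vnorm (L2 M) w)\<^sup>2 = cmod (vinner H u (S_B M k w))"
    unfolding inner_T_assignment[OF uw w Sw(1), symmetric] L2.inner_self[OF w] by (simp add: norm_power)
  also have "\<dots> \<le> vnorm H u * vnorm (L2 M) w"
    using Cauchy_Schwarz[OF u Sw(1)] mult_left_mono[OF Sw(2) norm_nonneg[OF u]] by linarith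
  finally show "vnorm (L2 M) w \<le> vnorm H u"
    using L2.norm_nonneg[OF w] norm_nonneg[OF u]
    by (cases "vnorm (L2 M) w = 0") (auto simp: power2_eq_square)
qed

lemma S_B_adjoint:
  assumes le: "K_mu M k \<lless> K" and \<Phi>: "\<Phi> \<in> vec (L2 M)"
  shows "S_B M k \<Phi> \<in> vec H"
    and "u \<in> vec H \<Longrightarrow> vinner (L2 M) (T_B K H M k u) \<Phi> = vinner H u (S_B M k \<Phi>)"
proof -
  let ?T = "T_B K H M k"
  have T: "?T u \<in> vec (L2 M)" "vnorm (L2 M) (?T u) \<le> vnorm H u"
    "?T (vscale H a u) = vscale (L2 M) a (?T u)" if "u \<in> vec H" for u a
    using T_B_contractive(2)[OF le] that unfolding contractive_operator_def linear_operator_def by auto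
  have T_add: "?T (vadd H u v) = vadd (L2 M) (?T u) (?T v)" if "u \<in> vec H" "v \<in> vec H" for u v
    using T_B_contractive(2)[OF le] that unfolding contractive_operator_def linear_operator_def by auto
  obtain v where v: "v \<in> vec H" "\<And>u. u \<in> vec H \<Longrightarrow> vinner H v u = vinner (L2 M) \<Phi> (?T u)"
  proof (rule functional_representation[of "vec H" "\<lambda>u. vinner (L2 M) \<Phi> (?T u)" "vnorm (L2 M) \<Phi>"])
    fix u assume u: "u \<in> vec H"
    show "cmod (vinner (L2 M) \<Phi> (?T u)) \<le> vnorm (L2 M) \<Phi> * vnorm H u"
      using L2.Cauchy_Schwarz[OF \<Phi> T(1)[OF u]] mult_left_mono[OF T(2)[OF u] L2.norm_nonneg[OF \<Phi>]]
      by linarith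
  qed (use \<Phi> in \<open>simp_all add: closed T T_add L2.inner_add L2.inner_scale\<close>)
  have adj: "vinner (L2 M) (?T u) \<Phi> = vinner H u v" if u: "u \<in> vec H" for u
    using v(2)[OF u] inner_commute[OF u v(1)] L2.inner_commute[OF T(1)[OF u] \<Phi>] by simp
  have "S_B M k \<Phi> = v"
  proof
    fix x
    have "v x = vinner (L2 M) (?T (\<lambda>y. K y x)) \<Phi>"
      using reproducing[OF v(1)] adj[OF kernel_section] by simp
    also have "?T (\<lambda>y. K y x) = L2_class M (k x)"
      by (rule T_B_assignment[OF T_B_contractive(1)[OF le] kernel_section_assignment])
    finally show "S_B M k \<Phi> x = v x" by (simp add: S_B_eq_inner[OF \<Phi>])
  qed
  then show "S_B M k \<Phi> \<in> vec H"
    "u \<in> vec H \<Longrightarrow> vinner (L2 M) (?T u) \<Phi> = vinner H u (S_B M k \<Phi>)"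
    using v adj by simp_all
qed

lemma S_B_contractive:
  assumes le: "K_mu M k \<lless> K"
  shows "contractive_operator (L2 M) H (S_B M k)"
  unfolding contractive_operator_def linear_operator_def
proof (intro conjI ballI allI)
  fix \<Phi> assume \<Phi>: "\<Phi> \<in> vec (L2 M)"
  show S: "S_B M k \<Phi> \<in> vec H" by (rule S_B_adjoint[OF le \<Phi>])
  show "S_B M k (vscale (L2 M) a \<Phi>) = vscale H a (S_B M k \<Phi>)" for a
    using \<Phi> by (auto simp: S_B_eq_inner L2.closed L2.inner_scale scale_pointwise
        L2_class_in_vec k_square_integrable)
  show "S_B M k (vadd (L2 M) \<Phi> \<Psi>) = vadd H (S_B M k \<Phi>) (S_B M k \<Psi>)"
    if "\<Psi> \<in> vec (L2 M)" for \<Psi>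
    using \<Phi> that by (auto simp: S_B_eq_inner L2.closed L2.inner_add add_pointwise
        L2_class_in_vec k_square_integrable)
  let ?T = "T_B K H M k"
  have T: "?T (S_B M k \<Phi>) \<in> vec (L2 M)" "vnorm (L2 M) (?T (S_B M k \<Phi>)) \<le> vnorm H (S_B M k \<Phi>)"
    using T_B_contractive(2)[OF le] S unfolding contractive_operator_def linear_operator_def by auto
  have "(vnorm H (S_B M k \<Phi>))\<^sup>2 = cmod (vinner (L2 M) (?T (S_B M k \<Phi>)) \<Phi>)"
    unfolding S_B_adjoint(2)[OF le \<Phi> S] inner_self[OF S] by (simp add: norm_power)
  also have "\<dots> \<le> vnorm H (S_B M k \<Phi>) * vnorm (L2 M) \<Phi>"
    using L2.Cauchy_Schwarz[OF T(1) \<Phi>] mult_right_mono[OF T(2) L2.norm_nonneg[OF \<Phi>]] by linarith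
  finally show "vnorm H (S_B M k \<Phi>) \<le> vnorm (L2 M) \<Phi>"
    using norm_nonneg[OF S] L2.norm_nonneg[OF \<Phi>]
    by (cases "vnorm H (S_B M k \<Phi>) = 0") (auto simp: power2_eq_square)
qed

lemma S_B_eq_adjoint_operator:
  assumes le: "K_mu M k \<lless> K" and \<Phi>: "\<Phi> \<in> vec (L2 M)"
  shows "S_B M k \<Phi> = adjoint_operator H (L2 M) (T_B K H M k) \<Phi>"
  unfolding adjoint_operator_def
proof (rule the_equality[symmetric])
  fix v assume "v \<in> vec H \<and> (\<forall>u\<in>vec H. vinner (L2 M) (T_B K H M k u) \<Phi> = vinner H u v)"
  then show "v = S_B M k \<Phi>"
    using S_B_adjoint[OF le \<Phi>] by (intro eq_by_inner) auto
qed (use S_B_adjoint[OF le \<Phi>] in auto)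

end

theorem theorem2p7:
  fixes K :: "'x \<Rightarrow> 'x \<Rightarrow> complex"
    and H :: "('x \<Rightarrow> complex) hspace"
    and M :: "'b measure"
    and k :: "'x \<Rightarrow> 'b \<Rightarrow> complex"
  assumes "pos_def_kernel K"
    and "rkhs K H"
    and "sigma_finite_measure M"
    and "\<And>x. k x \<in> square_integrable M"
  defines "cond_i \<equiv> K_mu M k \<lless> K"
    and "cond_ii \<equiv> well_defined_on (vec H) (T_graph K H M k) \<and>
                     contractive_operator H (L2 M) (T_B K H M k)"
    and "cond_iii \<equiv> contractive_operator (L2 M) H (S_B M k)"
  shows "(cond_i \<longleftrightarrow> cond_ii) \<and> (cond_ii \<longleftrightarrow> cond_iii) \<and>
    (cond_i \<longrightarrow> (\<forall>\<Phi>\<in>vec (L2 M). S_B M k \<Phi> = adjoint_operator H (L2 M) (T_B K H M k) \<Phi>))"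
proof -
  interpret rkhs_L2_family K H M k
    by (intro rkhs_L2_family.intro rkhs_L2_family_axioms.intro assms)
  have "cond_i \<longleftrightarrow> cond_ii"
    unfolding cond_i_def cond_ii_def using T_B_contractive kernel_le_if_T_B_contractive by blast
  moreover have "cond_i \<longleftrightarrow> cond_iii"
    unfolding cond_i_def cond_iii_def using S_B_contractive kernel_le_if_S_B_contractive by blast
  ultimately show ?thesis
    unfolding cond_i_def using S_B_eq_adjoint_operator by blast
qed

end
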